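(* Let $\ell\ge0$ and assume that for some fixed $s\in[1,2]$ $$\sup_{t\ge\rho}\int_{\tau(t)}^{t}|c(\zeta)|\,d\zeta\le s,\qquad \ell\le\Lambda(s),$$ where $\Lambda(s)=2+s-\sqrt{2s}-\ln\left(\sqrt{2s}-1\right)$. Then every $\ell$-rapidly oscillating solution of $x'(t)+c(t)x(\tau(t))=0$ is bounded. If moreover $\ell<\Lambda(s)$, then every $\ell$-rapidly oscillating solution tends to zero as $t\to\infty$.
   Context: Consider the equation $x'(t)+c(t)x(\tau(t))=0$, $t\ge 0$. Standing assumptions: $c:[0,\infty)\to\mathbb R$ (of arbitrary, possibly changing, sign) is Lebesgue measurable and locally integrable ($\int_0^t|c(u)|du<\infty$ for all $t\ge0$); $\tau:[0,\infty)\to\mathbb R$ is Lebesgue measurable, $\tau(t)\le t$ for all $t\ge 0$, and $\lim_{t\to\infty}\tau(t)=\infty$. For $t\ge0$ put $\tau_{\min}(t):=\inf_{v\ge t}\tau(v)$. Fix $a\ge 0$ with $\tau_{\min}(a)>0$ (such $a$ exists), and fix a number $\rho>\inf\{t>0:\tau_{\min}(t)>a\}$. A solution of the equation is a function $x:[\tau_{\min}(t_0),\infty)\to\mathbb R$, for some $t_0\in[\rho,\infty)$, which is absolutely continuous on $[\tau_{\min}(t_0),\infty)$ (i.e. on each compact subinterval) and satisfies the equation for almost every $t\in[t_0,\infty)$. For $\ell\in[0,\infty)$, a function $x$ defined (at least) on $[t_0,\infty)$ is called $\ell$-rapidly oscillating if it has arbitrarily large zeros and there is $t_1\ge t_0$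 such that for all $A,B\in[t_1,\infty)$ with $A<B$: if $x(v)\ne0$ for all $v\in(A,B)$, then $\int_A^B|c(v)|\,dv\le\ell$. *)

theory Defs
  imports "HOL-Analysis.Analysis"
begin

text \<open>
  Functions on \<open>[0,\<infinity>)\<close> or \<open>[\<tau>\<^sub>m\<^sub>i\<^sub>n(t0),\<infinity>)\<close> are total functions on \<^typ>\<open>real\<close>;
  every notion below reads their values on the intended domain only, with the sole exception that
  the two-sided derivative at the single point \<open>t0\<close> (a null set) may look outside it.
\<close>

text \<open>Extended-real valued: \<open>\<tau>\<close> need not be bounded below for small \<open>t\<close>, and the real \<open>Inf\<close>
  of a set that is not bounded below is unspecified.\<close>
definition tau_min :: "(real \<Rightarrow> real) \<Rightarrow> real \<Rightarrow> ereal" where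
  "tau_min \<tau> t = (INF v\<in>{t..}. ereal (\<tau> v))"

definition abs_cont_on_Icc :: "real \<Rightarrow> real \<Rightarrow> (real \<Rightarrow> real) \<Rightarrow> bool" where
  "abs_cont_on_Icc p q x \<longleftrightarrow>
    (\<forall>\<epsilon>>0. \<exists>\<delta>>0. \<forall>(n::nat) (u::nat \<Rightarrow> real) (v::nat \<Rightarrow> real).
       (\<forall>i<n. p \<le> u i \<and> u i \<le> v i \<and> v i \<le> q) \<longrightarrow>
       disjoint_family_on (\<lambda>i. {u i<..<v i}) {..<n} \<longrightarrow>
       (\<Sum>i<n. v i - u i) < \<delta> \<longrightarrow>
       (\<Sum>i<n. \<bar>x (v i) - x (u i)\<bar>) < \<epsilon>)"

definition solution_domain :: "(real \<Rightarrow> real) \<Rightarrow> real \<Rightarrow> real set" where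
  "solution_domain \<tau> t0 = {t. tau_min \<tau> t0 \<le> ereal t}"

definition is_solution ::
  "(real \<Rightarrow> real) \<Rightarrow> (real \<Rightarrow> real) \<Rightarrow> real \<Rightarrow> (real \<Rightarrow> real) \<Rightarrow> bool" where
  "is_solution c \<tau> t0 x \<longleftrightarrow>
    (\<forall>p\<in>solution_domain \<tau> t0. \<forall>q\<ge>p. abs_cont_on_Icc p q x) \<and>
    (AE t in lebesgue. t0 \<le> t \<longrightarrow>
       (\<exists>D. (x has_real_derivative D) (at t) \<and> D + c t * x (\<tau> t) = 0))"

definition rapidly_oscillating ::
  "(real \<Rightarrow> real) \<Rightarrow> real \<Rightarrow> real \<Rightarrow> (real \<Rightarrow> real) \<Rightarrow> bool" where
  "rapidly_oscillating c l t0 x \<longleftrightarrow>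
    (\<forall>T. \<exists>t\<ge>T. t0 \<le> t \<and> x t = 0) \<and>
    (\<exists>t1\<ge>t0. \<forall>A\<in>{t1..}. \<forall>B\<in>{t1..}. A < B \<longrightarrow>
       (\<forall>v\<in>{A<..<B}. x v \<noteq> 0) \<longrightarrow> (LINT v:{A..B}|lebesgue. \<bar>c v\<bar>) \<le> l)"

definition Lambda :: "real \<Rightarrow> real" where
  "Lambda s = 2 + s - sqrt (2 * s) - ln (sqrt (2 * s) - 1)"

end

theory Submission
  imports Defs
begin

text \<open>
  Measure time by the clock \<open>C t = \<integral>\<bar>c\<bar>\<close>. Let \<open>(A, B)\<close> be an interval between consecutive zeros of a
  solution \<open>x\<close> with \<open>\<bar>x\<bar> \<le> H\<close> so far. In clock time \<open>x\<close> moves at speed at most \<open>H\<close>, so a delayed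
  value taken before \<open>A\<close> is at most \<open>H min 1 (s - u)\<close> when the clock reads \<open>u = C t - C A\<close>, while one
  taken after \<open>A\<close> is bounded by the part of \<open>\<bar>x\<bar>\<close> already controlled. Hence \<open>\<bar>x\<bar>\<close> stays below \<open>H F u\<close>, where
  \<open>F' = max (min 1 (s - u)) F\<close> and \<open>F 0 = 0\<close>, and \<open>F\<close> reaches 1 exactly at \<open>u = \<Lambda>(s) - 1\<close>. The descent
  from level \<open>H\<close> to the zero \<open>B\<close> costs another unit of the clock. A strict new record of \<open>\<bar>x\<bar>\<close> in
  \<open>(A, B)\<close> would therefore need clock length more than \<open>\<Lambda>(s)\<close>, and if \<open>limsup \<bar>x\<bar> > 0\<close>, peaks close to
  the limsup need clock length nearly \<open>\<Lambda>(s)\<close>.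
\<close>

section \<open>Increments of absolutely continuous functions\<close>

text \<open>Riemann sums over a gauge-fine tagged division: tags outside \<open>N\<close> are handled by differentiability,
  and the gauge confines the pieces tagged in \<open>N\<close> to an open set so small that absolute continuity
  makes their contribution negligible.\<close>
lemma abs_cont_increment_le_integral:
  fixes x h :: "real \<Rightarrow> real"
  assumes ac: "abs_cont_on_Icc a b x" and ab: "a \<le> b"
    and N: "negligible N"
    and deriv: "\<And>t. t \<in> {a..b} - N \<Longrightarrow> \<exists>D. (x has_real_derivative D) (at t) \<and> \<bar>D\<bar> \<le> h t"
    and h: "h integrable_on {a..b}"
  shows "\<bar>x b - x a\<bar> \<le> integral {a..b} h"
proof -
  \<comment> \<open>\<open>h'\<close> vanishes on \<open>N\<close>, so tags in \<open>N\<close> add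
    nothing to its Riemann sums, while the integral is unchanged.\<close>
  define h' where "h' t = (if t \<in> N then 0 else h t)" for t
  define I where "I = integral {a..b} h"
  have h'I: "(h' has_integral I) {a..b}"
    by (rule has_integral_spike[OF N _ integrable_integral[OF h, folded I_def]]) (simp add: h'_def)
  have h'_nonneg: "0 \<le> h' t" if "t \<in> {a..b}" for t
    using deriv[of t] that by (fastforce simp: h'_def)
  \<comment> \<open>Error budget: one \<open>e\<close> for the pieces tagged in \<open>N\<close>,
    one for the Riemann sum, and \<open>e * (b - a)\<close> for the differentiability
    estimate.\<close>
  have main: "\<bar>x b - x a\<bar> \<le> I + e * (2 + (b - a))" if e: "e > 0" for e
  proof -
    obtain \<gamma>0 where \<gamma>0: "gauge \<gamma>0"
      and \<gamma>0_fine: "\<And>p. \<lbrakk>p tagged_division_of {a..b}; \<gamma>0 fine p\<rbrakk> \<Longrightarrow>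
            norm ((\<Sum>(t,k)\<in>p. measure lborel k *\<^sub>R h' t) - I) < e"
      using h'I e unfolding has_integral_real by meson
    obtain d where d: "d > 0"
      and d_ac: "\<And>(n::nat) u v. \<lbrakk>\<forall>i<n. a \<le> u i \<and> u i \<le> v i \<and> v i \<le> b;
            disjoint_family_on (\<lambda>i. {u i<..<v i}) {..<n}; (\<Sum>i<n. v i - u i) < d\<rbrakk>
            \<Longrightarrow> (\<Sum>i<n. \<bar>x (v i) - x (u i)\<bar>) < e"
      using ac e unfolding abs_cont_on_Icc_def by meson
    have N_null: "N \<in> null_sets lebesgue"
      using N negligible_iff_null_sets by blast
    then obtain U where U: "open U" "N \<subseteq> U" "U - N \<in> lmeasurable"
        "emeasure lebesgue (U - N) < ennreal d"
      using sets_lebesgue_outer_open[of N d] d by blast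
    have U_em: "emeasure lebesgue U < ennreal d"
    proof -
      have "emeasure lebesgue (U - N) = emeasure lebesgue U"
        by (rule emeasure_Diff_null_set[OF N_null]) (simp add: U(1) borel_open)
      then show ?thesis
        using U(4) by simp
    qed
    have "\<exists>r>0. \<forall>y. \<bar>y - t\<bar> < r \<longrightarrow> \<bar>x y - x t\<bar> \<le> (h t + e) * \<bar>y - t\<bar>"
      if t: "t \<in> {a..b} - N" for t
    proof -
      obtain D where D: "(x has_real_derivative D) (at t)" "\<bar>D\<bar> \<le> h t"
        using deriv[OF t] by blast
      have "(x has_derivative (\<lambda>y. D * y)) (at t)"
        using D(1) by (simp add: has_field_derivative_def)
      then obtain r where r: "r > 0"
        and bnd: "\<And>y. norm (y - t) < r \<Longrightarrow> norm (x y - x t - D * (y - t)) \<le> e * norm (y - t)"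
        using e unfolding has_derivative_at_alt by meson
      have "\<bar>x y - x t\<bar> \<le> (h t + e) * \<bar>y - t\<bar>" if "\<bar>y - t\<bar> < r" for y
      proof -
        have "\<bar>x y - x t\<bar> \<le> \<bar>D * (y - t)\<bar> + e * \<bar>y - t\<bar>"
          using bnd[of y] that by (simp add: abs_if split: if_splits)
        also have "\<bar>D * (y - t)\<bar> \<le> h t * \<bar>y - t\<bar>"
          unfolding abs_mult by (rule mult_right_mono[OF D(2)]) simp
        finally show ?thesis by (simp add: algebra_simps)
      qed
      then show ?thesis using r by blast
    qed
    then obtain r where r: "\<And>t. t \<in> {a..b} - N \<Longrightarrow> r t > 0"
      and r_bnd: "\<And>t y. \<lbrakk>t \<in> {a..b} - N; \<bar>y - t\<bar> < r t\<rbrakk> \<Longrightarrow> \<bar>x y - x t\<bar> \<le> (h t + e) * \<bar>y - t\<bar>"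
      by metis
    define \<gamma>1 where "\<gamma>1 t = (if t \<in> N then U else if t \<in> {a..b} then ball t (r t) else UNIV)" for t
    have "gauge \<gamma>1"
      using U r by (auto simp: gauge_def \<gamma>1_def)
    then have "gauge (\<lambda>t. \<gamma>0 t \<inter> \<gamma>1 t)"
      by (rule gauge_Int[OF \<gamma>0])
    then obtain p where p: "p tagged_division_of {a..b}" and "(\<lambda>t. \<gamma>0 t \<inter> \<gamma>1 t) fine p"
      by (rule fine_division_exists_real)
    then have fine0: "\<gamma>0 fine p" and fine1: "\<gamma>1 fine p"
      by (auto simp: fine_Int)
    note pD = tagged_division_ofD[OF p]
    have k: "\<exists>c d. k = {c..d} \<and> a \<le> c \<and> c \<le> t \<and> t \<le> d \<and> d \<le> b \<and> Inf k = c \<and> Sup k = d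
        \<and> measure lborel k = d - c \<and> t \<in> {a..b}"
      if mem: "(t, k) \<in> p" for t k
    proof -
      obtain c d where cd: "k = {c..d}"
        using pD(4)[OF mem] by auto
      have "c \<le> t" "t \<le> d" using pD(2)[OF mem] cd by auto
      moreover have "a \<le> c" "d \<le> b" using pD(3)[OF mem] cd calculation by auto
      ultimately show ?thesis using cd by auto
    qed
    define P where "P = {z \<in> p. fst z \<in> N}"
    define Q where "Q = {z \<in> p. fst z \<notin> N}"
    have PQ: "p = P \<union> Q" "P \<inter> Q = {}" "finite P" "finite Q"
      using pD(1) by (auto simp: P_def Q_def)
    let ?\<Delta> = "\<lambda>z. \<bar>x (Sup (snd z)) - x (Inf (snd z))\<bar>"
    have bad: "sum ?\<Delta> P < e"
    proof -
      \<comment> \<open>Absolute continuity speaks of indexed families, so the pieces are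
        enumerated; their interiors are disjoint and lie in \<open>U\<close>, hence have total
        length below \<open>d\<close>.\<close>
      obtain f where f: "bij_betw f {..<card P} P"
        using ex_bij_betw_nat_finite[OF PQ(3)] atLeast0LessThan by metis
      define u where "u i = Inf (snd (f i))" for i
      define v where "v i = Sup (snd (f i))" for i
      have fP: "f i \<in> P" if "i < card P" for i
        using f that by (auto simp: bij_betw_def)
      have ik: "a \<le> u i \<and> u i \<le> v i \<and> v i \<le> b \<and> snd (f i) = {u i..v i} \<and> {u i..v i} \<subseteq> U"
        if "i < card P" for i
      proof -
        obtain t k where tk: "f i = (t, k)" by fastforce
        with fP[OF that] have mem: "(t, k) \<in> p" "t \<in> N" by (auto simp: P_def)
        moreover have "k \<subseteq> U"
          using fineD[OF fine1 mem(1)] mem(2) by (simp add: \<gamma>1_def)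
        ultimately show ?thesis using k[OF mem(1)] tk by (auto simp: u_def v_def)
      qed
      have disj: "disjoint_family_on (\<lambda>i. {u i<..<v i}) {..<card P}"
        unfolding disjoint_family_on_def
      proof (intro ballI impI)
        fix i j assume ij: "i \<in> {..<card P}" "j \<in> {..<card P}" "i \<noteq> j"
        then have "f i \<noteq> f j" using f by (auto simp: bij_betw_def inj_on_def)
        then have "interior (snd (f i)) \<inter> interior (snd (f j)) = {}"
          using pD(5)[of "fst (f i)" "snd (f i)" "fst (f j)" "snd (f j)"] fP ij
          by (auto simp: P_def)
        then show "{u i<..<v i} \<inter> {u j<..<v j} = {}"
          using ik ij by (simp add: interior_atLeastAtMost_real)
      qed
      have "ennreal (\<Sum>i<card P. v i - u i) = (\<Sum>i<card P. emeasure lebesgue {u i<..<v i})"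
        using ik by (subst sum_ennreal[symmetric]) auto
      also have "\<dots> = emeasure lebesgue (\<Union>i<card P. {u i<..<v i})"
        by (rule sum_emeasure) (use disj in auto)
      also have "\<dots> \<le> emeasure lebesgue U"
        using ik by (intro emeasure_mono) (fastforce simp: U(1) borel_open)+
      also have "\<dots> < ennreal d" by (rule U_em)
      finally have "(\<Sum>i<card P. v i - u i) < d"
        using ik by (subst (asm) ennreal_less_iff) (auto intro!: sum_nonneg)
      then have "(\<Sum>i<card P. \<bar>x (v i) - x (u i)\<bar>) < e"
        using d_ac[OF _ disj] ik by blast
      also have "(\<Sum>i<card P. \<bar>x (v i) - x (u i)\<bar>) = sum ?\<Delta> P"
        unfolding u_def v_def by (rule sum.reindex_bij_betw[OF f])
      finally show ?thesis .
    qed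
    have good: "sum ?\<Delta> Q \<le> (\<Sum>(t,k)\<in>p. measure lborel k * h' t + e * measure lborel k)"
    proof -
      have "sum ?\<Delta> Q \<le> (\<Sum>(t,k)\<in>Q. measure lborel k * h' t + e * measure lborel k)"
      proof (rule sum_mono)
        fix z assume z: "z \<in> Q"
        obtain t k where tk: "z = (t, k)" by fastforce
        have mem: "(t, k) \<in> p" "t \<notin> N" using z tk by (auto simp: Q_def)
        obtain c d where cd: "k = {c..d}" "c \<le> t" "t \<le> d" "Inf k = c" "Sup k = d"
            "measure lborel k = d - c" "t \<in> {a..b}"
          using k[OF mem(1)] by blast
        \<comment> \<open>Both endpoints of the piece lie in the ball around its tag, so the
          estimates from \<open>c\<close> to \<open>t\<close> and from \<open>t\<close> to
          \<open>d\<close> can be added.\<close>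
        have "k \<subseteq> ball t (r t)"
          using fineD[OF fine1 mem(1)] mem(2) cd(7) by (simp add: \<gamma>1_def)
        moreover have "c \<in> k" "d \<in> k" using cd by auto
        ultimately have "c \<in> ball t (r t)" "d \<in> ball t (r t)" by blast+
        then have "\<bar>c - t\<bar> < r t" "\<bar>d - t\<bar> < r t" by (auto simp: dist_real_def)
        then have "\<bar>x c - x t\<bar> \<le> (h t + e) * (t - c)" "\<bar>x d - x t\<bar> \<le> (h t + e) * (d - t)"
          using r_bnd[of t c] r_bnd[of t d] mem cd by auto
        then have "\<bar>x d - x c\<bar> \<le> (h t + e) * (t - c) + (h t + e) * (d - t)" by linarith
        also have "\<dots> = (d - c) * h t + e * (d - c)" by (simp add: algebra_simps)
        finally show "?\<Delta> z \<le> (case z of (t, k) \<Rightarrow> measure lborel k * h' t + e * measure lborel k)"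
          using mem by (simp add: tk cd(4-6) h'_def)
      qed
      also have "\<dots> \<le> (\<Sum>(t,k)\<in>p. measure lborel k * h' t + e * measure lborel k)"
        using PQ pD(1) h'_nonneg e k
        by (intro sum_mono2) (auto intro!: add_nonneg_nonneg mult_nonneg_nonneg)
      finally show ?thesis .
    qed
    have "(\<Sum>(t,k)\<in>p. measure lborel k * h' t + e * measure lborel k)
        = (\<Sum>(t,k)\<in>p. measure lborel k *\<^sub>R h' t) + e * (\<Sum>(t,k)\<in>p. measure lborel k)"
      by (simp add: sum.distrib sum_distrib_left case_prod_unfold)
    also have "(\<Sum>(t,k)\<in>p. measure lborel k) = b - a"
      using additive_content_tagged_division[of p a b] p ab by simp
    finally have "sum ?\<Delta> Q \<le> I + e + e * (b - a)"
      using good \<gamma>0_fine[OF p fine0] by (auto simp: abs_if split: if_splits)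
    moreover have "x b - x a = (\<Sum>z\<in>p. x (Sup (snd z)) - x (Inf (snd z)))"
      using additive_tagged_division_1[OF ab p, of x] by (simp add: case_prod_unfold)
    then have "\<bar>x b - x a\<bar> \<le> sum ?\<Delta> p"
      by (simp add: sum_abs)
    moreover have "sum ?\<Delta> p = sum ?\<Delta> P + sum ?\<Delta> Q"
      using PQ by (simp add: sum.union_disjoint)
    ultimately show ?thesis
      using bad by (simp add: algebra_simps)
  qed
  have "\<bar>x b - x a\<bar> \<le> I + e" if "e > 0" for e
    using main[of "e / (2 + (b - a))"] that ab by simp
  then show ?thesis
    unfolding I_def by (rule field_le_epsilon)
qed

lemma continuous_on_atLeast_if_Icc:
  fixes f :: "real \<Rightarrow> real"
  assumes "\<And>q. m \<le> q \<Longrightarrow> continuous_on {m..q} f"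
  shows "continuous_on {m..} f"
  unfolding continuous_on_iff
proof (intro ballI allI impI)
  fix y e :: real assume y: "y \<in> {m..}" and e: "0 < e"
  have "continuous_on {m..y + 1} f" using y by (intro assms) auto
  then obtain d where d: "d > 0"
    and close: "\<And>t. t \<in> {m..y + 1} \<Longrightarrow> dist t y < d \<Longrightarrow> dist (f t) (f y) < e"
    using y e unfolding continuous_on_iff by (metis add_increasing2 atLeastAtMost_iff atLeast_iff order_refl zero_le_one)
  have "dist (f t) (f y) < e" if "t \<in> {m..}" "dist t y < min d 1" for t
    using that by (intro close) (auto simp: dist_real_def)
  then show "\<exists>d>0. \<forall>t\<in>{m..}. dist t y < d \<longrightarrow> dist (f t) (f y) < e"
    using d by (intro exI[of _ "min d 1"]) auto
qed

lemma abs_cont_on_Icc_imp_continuous_on: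
  assumes "abs_cont_on_Icc p q x"
  shows "continuous_on {p..q} x"
  unfolding continuous_on_iff
proof (intro ballI allI impI)
  fix y e :: real assume y: "y \<in> {p..q}" and e: "0 < e"
  obtain d where d: "d > 0"
    and ac: "\<And>(n::nat) u v. \<lbrakk>\<forall>i<n. p \<le> u i \<and> u i \<le> v i \<and> v i \<le> q;
            disjoint_family_on (\<lambda>i. {u i<..<v i}) {..<n}; (\<Sum>i<n. v i - u i) < d\<rbrakk>
            \<Longrightarrow> (\<Sum>i<n. \<bar>x (v i) - x (u i)\<bar>) < e"
    using assms e unfolding abs_cont_on_Icc_def by meson
  have close: "\<bar>x v - x u\<bar> < e" if "p \<le> u" "u \<le> v" "v \<le> q" "v - u < d" for u v
    using ac[of 1 "\<lambda>_. u" "\<lambda>_. v"] that by (simp add: disjoint_family_on_def)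
  have "dist (x t) (x y) < e" if "t \<in> {p..q}" "dist t y < d" for t
    using close[of t y] close[of y t] that y by (cases "t \<le> y") (auto simp: dist_real_def)
  then show "\<exists>d>0. \<forall>t\<in>{p..q}. dist t y < d \<longrightarrow> dist (x t) (x y) < e"
    using d by blast
qed

section \<open>The comparison profile and the constant \<open>Lambda s\<close>\<close>

text \<open>The level at which the profile \<open>F\<close> meets the line \<open>s - u\<close>; from there on it grows exponentially.\<close>
definition rise_threshold :: "real \<Rightarrow> real" where
  "rise_threshold s = sqrt (2 * s) - 1"

text \<open>The slope is 1 while \<open>s - u\<close> is at least 1, then \<open>s - u\<close> until
  the profile catches up with that line, then the profile itself. The constants make the branches
  meet.\<close>

definition rise_profile :: "real \<Rightarrow> real \<Rightarrow> real" where
  "rise_profile s u =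
    (let w = rise_threshold s in
     if u \<le> s - 1 then u
     else if u \<le> s - w then s - 1 / 2 - (s - u)\<^sup>2 / 2
     else w * exp (u - (s - w)))"

text \<open>Writing w for the threshold, the quadratic identity says that the middle branch takes
  the value w at \<open>s - w\<close>, so it meets the line there. The range of \<open>s\<close>
  puts w in (0, 1], which orders the break points \<open>s - 1\<close> and
  \<open>s - w\<close>.\<close>

lemma rise_threshold:
  assumes "s \<in> {1..2}"
  shows "0 < rise_threshold s" "rise_threshold s \<le> 1"
    and "(rise_threshold s + 1)\<^sup>2 = 2 * s"
proof -
  have "1 < sqrt (2 * s)" using assms by (intro real_less_rsqrt) auto
  then show "0 < rise_threshold s" by (simp add: rise_threshold_def)
  have "sqrt (2 * s) \<le> 2" using assms by (intro real_le_lsqrt) auto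
  then show "rise_threshold s \<le> 1" by (simp add: rise_threshold_def)
  show "(rise_threshold s + 1)\<^sup>2 = 2 * s" using assms by (simp add: rise_threshold_def)
qed

text \<open>The clock budget of an excursion: \<open>s - w\<close> to reach the threshold w,
  \<open>- ln w\<close> for the exponential growth from w to 1, and one unit for the
  descent.\<close>

lemma Lambda_eq: "Lambda s = 1 + (s - rise_threshold s - ln (rise_threshold s))"
  by (simp add: Lambda_def rise_threshold_def)

lemma rise_profile_at_threshold:
  assumes "s \<in> {1..2}"
  shows "rise_profile s (s - rise_threshold s) = rise_threshold s"
proof -
  note w = rise_threshold[OF assms]
  have "s - 1 / 2 - (rise_threshold s)\<^sup>2 / 2 = rise_threshold s"
    using w(3) by (simp add: power2_eq_square field_simps)
  then show ?thesis
    using w by (auto simp: rise_profile_def Let_def)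
qed

lemma rise_profile_at_end:
  assumes "s \<in> {1..2}"
  shows "rise_profile s (Lambda s - 1) = 1"
proof -
  note w = rise_threshold[OF assms]
  have "ln (rise_threshold s) \<le> 0" using w by simp
  \<comment> \<open>If w = 1 the exponential phase is empty and the end point is the threshold
    itself, where the definition selects another branch.\<close>
  consider "ln (rise_threshold s) = 0" | "ln (rise_threshold s) < 0"
    using \<open>ln (rise_threshold s) \<le> 0\<close> by linarith
  then show ?thesis
  proof cases
    case 1
    then have "rise_threshold s = 1" using w ln_eq_zero_iff by blast
    then show ?thesis
      using rise_profile_at_threshold[OF assms] by (simp add: Lambda_eq)
  next
    case 2
    then have "\<not> Lambda s - 1 \<le> s - 1" "\<not> Lambda s - 1 \<le> s - rise_threshold s"
      using w unfolding Lambda_eq by linarith+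
    moreover have "Lambda s - 1 - (s - rise_threshold s) = - ln (rise_threshold s)"
      by (simp add: Lambda_eq)
    ultimately show ?thesis
      using w by (simp add: rise_profile_def Let_def exp_minus)
  qed
qed

lemma rise_profile_zero:
  assumes "s \<in> {1..2}"
  shows "rise_profile s 0 = 0"
  using assms by (simp add: rise_profile_def)

text \<open>The profile solves \<open>F' = max (min 1 (s - u)) F\<close>, \<open>F 0 = 0\<close>; the right-hand side is bounded
  below on \<open>[p, q]\<close> by the value used here, since \<open>F\<close> increases.\<close>
lemma rise_profile_growth:
  assumes s: "s \<in> {1..2}" and pq: "0 \<le> p" "p \<le> q"
  shows "(q - p) * max (min 1 (s - q)) (rise_profile s p) \<le> rise_profile s q - rise_profile s p"
proof -
  define w where "w = rise_threshold s"
  define F where "F = rise_profile s"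
  let ?G = "\<lambda>p q. (q - p) * max (min 1 (s - q)) (F p) \<le> F q - F p"
  have w: "0 < w" "w \<le> 1" "(w + 1)\<^sup>2 = 2 * s"
    using rise_threshold[OF s] by (simp_all add: w_def)
  have ws: "s - 1 / 2 - w\<^sup>2 / 2 = w"
    using w(3) by (simp add: power2_eq_square field_simps)
  have F1: "F u = u" if "u \<le> s - 1" for u
    using that by (simp add: F_def rise_profile_def)
  have F2: "F u = s - 1 / 2 - (s - u)\<^sup>2 / 2" if "s - 1 \<le> u" "u \<le> s - w" for u
    using that by (auto simp: F_def rise_profile_def w_def Let_def)
  have F3: "F u = w * exp (u - (s - w))" if "s - w \<le> u" for u
  proof (cases "u = s - w")
    case True
    then show ?thesis
      using rise_profile_at_threshold[OF s] by (simp add: F_def w_def)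
  next
    case False
    then show ?thesis
      using that w by (auto simp: F_def rise_profile_def w_def Let_def)
  qed
  \<comment> \<open>Here the profile is the identity and stays at most 1 because \<open>s\<close>
    \<le> 2, so the rate is at most 1.\<close>
  have G1: "?G p q" if "0 \<le> p" "p \<le> q" "q \<le> s - 1" for p q
  proof -
    have "max (min 1 (s - q)) (F p) \<le> 1" using that s by (simp add: F1)
    then have "(q - p) * max (min 1 (s - q)) (F p) \<le> (q - p) * 1"
      using that by (intro mult_left_mono) auto
    then show ?thesis using that by (simp add: F1)
  qed
  \<comment> \<open>Here the profile is still at most w, hence at most \<open>s - q\<close>; the
    concave parabola leaves a surplus of \<open>(q - p)\<^sup>2 / 2\<close>.\<close>
  have G2: "?G p q" if "s - 1 \<le> p" "p \<le> q" "q \<le> s - w" for p q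
  proof -
    have "w\<^sup>2 \<le> (s - p)\<^sup>2" using that w by (intro power_mono) auto
    then have "F p \<le> w" using that ws by (simp add: F2)
    then have "max (min 1 (s - q)) (F p) \<le> s - q" using that by auto
    then have "(q - p) * max (min 1 (s - q)) (F p) \<le> (q - p) * (s - q)"
      using that by (intro mult_left_mono) auto
    also have "\<dots> \<le> F q - F p"
    proof -
      have "F q - F p - (q - p) * (s - q) = (q - p)\<^sup>2 / 2"
        using that by (simp add: F2) (simp add: power2_eq_square field_simps)
      moreover have "0 \<le> (q - p)\<^sup>2 / 2" by simp
      ultimately show ?thesis by linarith
    qed
    finally show ?thesis .
  qed
  \<comment> \<open>Past the threshold the profile dominates the line, and 1 + z \<le> exp z
    suffices.\<close>
  have G3: "?G p q" if "s - w \<le> p" "p \<le> q" for p q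
  proof -
    have Fp: "w \<le> F p" using that w by (simp add: F3)
    then have "max (min 1 (s - q)) (F p) = F p" using that by auto
    moreover have "F q = F p * exp (q - p)"
      using that by (simp add: F3 exp_add[symmetric])
    moreover have "F p * (1 + (q - p)) \<le> F p * exp (q - p)"
      using Fp w by (intro mult_left_mono exp_ge_add_one_self) auto
    ultimately show ?thesis by (simp add: algebra_simps)
  qed
  \<comment> \<open>Splitting at \<open>b\<close> only raises the rates: \<open>s - q\<close>
    decreases in \<open>q\<close>, and \<open>F p\<close> \<le> \<open>F b\<close>.\<close>
  have glue: "?G p q" if "p \<le> b" "b \<le> q" and G: "?G p b" "?G b q" and "0 \<le> F p" for p b q
  proof -
    have "0 \<le> (b - p) * max (min 1 (s - b)) (F p)"
      using that by (intro mult_nonneg_nonneg) auto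
    then have "F p \<le> F b" using G by linarith
    then have "(q - b) * max (min 1 (s - q)) (F p) \<le> (q - b) * max (min 1 (s - q)) (F b)"
      using that by (intro mult_left_mono) auto
    moreover have "(b - p) * max (min 1 (s - q)) (F p) \<le> (b - p) * max (min 1 (s - b)) (F p)"
      using that by (intro mult_left_mono) auto
    moreover have "(q - p) * max (min 1 (s - q)) (F p)
        = (q - b) * max (min 1 (s - q)) (F p) + (b - p) * max (min 1 (s - q)) (F p)"
      by (simp add: algebra_simps)
    ultimately show ?thesis using G by linarith
  qed
  have Fnn2: "0 \<le> F p" if "s - 1 \<le> p" "p \<le> s - w" for p
  proof -
    have "(s - p)\<^sup>2 \<le> 1" using that w by (intro power_le_one) auto
    then show ?thesis using that s by (simp add: F2)
  qed
  have G23: "?G p q" if "s - 1 \<le> p" "p \<le> q" for p q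
    using glue[of p "s - w" q] G2[of p q] G2[of p "s - w"] G3[of p q] G3[of "s - w" q]
      Fnn2[of p] that by fastforce
  have "?G p q"
    using glue[of p "s - 1" q] G1[of p q] G1[of p "s - 1"] G23[of p q] G23[of "s - 1" q]
      F1[of p] pq by fastforce
  then show ?thesis by (simp add: F_def)
qed

lemma rise_profile_nonneg:
  assumes "s \<in> {1..2}" "0 \<le> u"
  shows "0 \<le> rise_profile s u"
proof -
  have "0 \<le> u * max (min 1 (s - u)) (rise_profile s 0)"
    using assms by (intro mult_nonneg_nonneg) (auto simp: rise_profile_zero)
  then show ?thesis
    using rise_profile_growth[OF assms(1) order_refl assms(2)] by (simp add: rise_profile_zero[OF assms(1)])
qed

text \<open>Up to clock time \<open>Lambda s - 1\<close>, where the profile equals 1, its slope is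
  at least the threshold w: first through the line, then through its own value. A deficit of
  \<open>1 - r\<close> in height therefore saves at most \<open>(1 - r) / w\<close> of
  clock.\<close>

lemma rise_profile_ge_imp_late:
  assumes s: "s \<in> {1..2}" and "0 \<le> p" "r \<le> 1" "r \<le> rise_profile s p"
  shows "Lambda s - 1 - (1 - r) / rise_threshold s \<le> p"
proof (cases "Lambda s - 1 \<le> p")
  case True
  moreover have "0 \<le> (1 - r) / rise_threshold s"
    using rise_threshold[OF s] assms by simp
  ultimately show ?thesis by linarith
next
  case False
  define w where "w = rise_threshold s"
  define F where "F = rise_profile s"
  define U where "U = Lambda s - 1"
  have w: "0 < w" "w \<le> 1"
    using rise_threshold[OF s] by (simp_all add: w_def)
  have "ln w \<le> 0" using w by simp
  then have U: "s - w \<le> U" "p < U" "F U = 1"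
    using False rise_profile_at_end[OF s] by (simp_all add: U_def Lambda_eq F_def w_def)
  have sw: "0 \<le> s - w" using s w by simp
  have Fsw: "F (s - w) = w"
    using rise_profile_at_threshold[OF s] by (simp add: F_def w_def)
  have grow: "(q - p) * z \<le> F q - F p"
    if "0 \<le> p" "p \<le> q" "z \<le> max (min 1 (s - q)) (F p)" for p q z
  proof -
    have "(q - p) * z \<le> (q - p) * max (min 1 (s - q)) (F p)"
      using that by (intro mult_left_mono) auto
    also have "\<dots> \<le> F q - F p"
      unfolding F_def by (rule rise_profile_growth[OF s that(1,2)])
    finally show ?thesis .
  qed
  have "(U - p) * w \<le> F U - F p"
  proof (cases "p \<le> s - w")
    case True
    have "(s - w - p) * w \<le> F (s - w) - F p"
      using True w assms by (intro grow) auto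
    moreover have "(U - (s - w)) * w \<le> F U - F (s - w)"
      using U sw by (intro grow) (auto simp: Fsw)
    ultimately show ?thesis by (simp add: algebra_simps)
  next
    case False
    then have "0 \<le> (p - (s - w)) * w" using w by simp
    also have "\<dots> \<le> F p - F (s - w)"
      using False sw by (intro grow) (auto simp: Fsw)
    finally have "w \<le> F p" by (simp add: Fsw)
    then show ?thesis using U assms by (intro grow) auto
  qed
  then have "(U - p) * w \<le> 1 - r" using U assms by (simp add: F_def)
  then show ?thesis
    using w by (simp add: w_def[symmetric] U_def[symmetric] field_simps)
qed

lemma rise_profile_continuous:
  assumes s: "s \<in> {1..2}"
  shows "continuous_on S (rise_profile s)"
proof -
  define w where "w = rise_threshold s"
  have w: "w \<le> 1" "(w + 1)\<^sup>2 = 2 * s"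
    using rise_threshold[OF s] by (simp_all add: w_def)
  have ws: "s - 1 / 2 = w + w\<^sup>2 / 2"
    using w(2) by (simp add: power2_eq_square field_simps)
  \<comment> \<open>The profile is the sum of the amounts gained in the three phases, each frozen
    outside its phase by \<open>min\<close> and \<open>max\<close>; in this form continuity is
    immediate.\<close>
  have "rise_profile s u = min u (s - 1) + (1 - (s - max (s - 1) (min u (s - w)))\<^sup>2) / 2
      + w * (exp (max u (s - w) - (s - w)) - 1)" for u
  proof -
    consider "u \<le> s - 1" | "s - 1 < u" "u \<le> s - w" | "s - w < u" by linarith
    then show ?thesis
    proof cases
      case 1
      then have "max (s - 1) (min u (s - w)) = s - 1" "max u (s - w) = s - w" using w by auto
      with 1 show ?thesis by (simp add: rise_profile_def)
    next
      case 2
      then have "max (s - 1) (min u (s - w)) = u" "max u (s - w) = s - w" by auto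
      with 2 show ?thesis by (simp add: rise_profile_def w_def[symmetric] Let_def field_simps)
    next
      case 3
      then have "max (s - 1) (min u (s - w)) = s - w" "max u (s - w) = u" "min u (s - 1) = s - 1"
        using w by auto
      moreover have "rise_profile s u = w * exp (u - (s - w))"
        using 3 w by (simp add: rise_profile_def w_def[symmetric] Let_def)
      moreover have "s - 1 + (1 - w\<^sup>2) / 2 = w" using ws by (simp add: field_simps)
      ultimately show ?thesis by (simp add: right_diff_distrib)
    qed
  qed
  then have "rise_profile s = (\<lambda>u. min u (s - 1) + (1 - (s - max (s - 1) (min u (s - w)))\<^sup>2) / 2
      + w * (exp (max u (s - w) - (s - w)) - 1))"
    by blast
  then show ?thesis by (simp only:) (intro continuous_intros, simp)
qed

section \<open>First hitting times and neighbouring zeros\<close>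

lemma first_hitting_time:
  fixes f :: "real \<Rightarrow> real"
  assumes "continuous_on {a..b} f" "a \<le> b" "f a \<le> y" "y \<le> f b"
  obtains c where "c \<in> {a..b}" "f c = y" "\<And>t. t \<in> {a..<c} \<Longrightarrow> f t < y"
proof -
  define S where "S = {t \<in> {a..b}. f t = y}"
  have "compact S"
    unfolding S_def using continuous_closed_preimage_constant[OF assms(1) closed_atLeastAtMost, of y]
    by (auto simp: compact_eq_bounded_closed intro: bounded_subset[OF bounded_closed_interval[of a b]])
  moreover have "S \<noteq> {}"
    using IVT'[of f a y b] assms by (auto simp: S_def)
  ultimately obtain c where c: "c \<in> S" "\<And>t. t \<in> S \<Longrightarrow> c \<le> t"
    using compact_attains_inf by metis
  have "f t < y" if t: "t \<in> {a..<c}" for t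
  proof (rule ccontr)
    assume "\<not> f t < y"
    moreover have "continuous_on {a..t} f"
      using assms(1) by (rule continuous_on_subset) (use t c(1) in \<open>auto simp: S_def\<close>)
    ultimately obtain t' where "a \<le> t'" "t' \<le> t" "f t' = y"
      using IVT'[of f a y t] assms t by auto
    then show False using c t by (force simp: S_def)
  qed
  with c(1) that show ?thesis by (auto simp: S_def)
qed

text \<open>The zeros on either side of \<open>t\<close> form compact sets; \<open>A\<close> is the
  last one before \<open>t\<close> and \<open>B\<close> the first one after it.\<close>

lemma enclosing_zeros:
  fixes x :: "real \<Rightarrow> real"
  assumes cont: "continuous_on {Z..Y} x" and Z: "x Z = 0" "Z \<le> t" and Y: "x Y = 0" "t \<le> Y"
    and t: "x t \<noteq> 0"
  obtains A B where "Z \<le> A" "A < t" "t < B" "B \<le> Y" "x A = 0" "x B = 0"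
    "\<And>v. v \<in> {A<..<B} \<Longrightarrow> x v \<noteq> 0"
proof -
  have comp: "compact {v \<in> {p..q}. x v = 0}" if "Z \<le> p" "q \<le> Y" for p q
  proof -
    have "continuous_on {p..q} x"
      using cont by (rule continuous_on_subset) (use that in auto)
    then show ?thesis
      using continuous_closed_preimage_constant[OF _ closed_atLeastAtMost, of p q x 0]
      by (auto simp: compact_eq_bounded_closed intro: bounded_subset[OF bounded_closed_interval[of p q]])
  qed
  have "{v \<in> {Z..t}. x v = 0} \<noteq> {}" "{v \<in> {t..Y}. x v = 0} \<noteq> {}"
    using Z Y by auto
  then obtain A B where A: "A \<in> {v \<in> {Z..t}. x v = 0}" "\<forall>v\<in>{v \<in> {Z..t}. x v = 0}. v \<le> A"
    and B: "B \<in> {v \<in> {t..Y}. x v = 0}" "\<forall>v\<in>{v \<in> {t..Y}. x v = 0}. B \<le> v"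
    using compact_attains_sup[OF comp[OF order_refl Y(2)]]
      compact_attains_inf[OF comp[OF Z(2) order_refl]] by auto
  have "A \<noteq> t" "B \<noteq> t" using A B t by auto
  moreover have "x v \<noteq> 0" if v: "v \<in> {A<..<B}" for v
  proof
    assume "x v = 0"
    then have "v \<le> t \<Longrightarrow> v \<le> A" "t \<le> v \<Longrightarrow> B \<le> v"
      using A B v by auto
    with v show False by (cases "v \<le> t") auto
  qed
  ultimately show ?thesis using that[of A B] A(1) B(1) by auto
qed

section \<open>Growth after a zero, boundedness and decay in clock time\<close>

text \<open>The only information kept about the equation: with the clock \<open>C t = \<integral>\<bar>c\<bar>\<close>, the
  solution is Lipschitz with any bound on the delayed values as constant, and the delay is at
  most \<open>s\<close>.\<close>
locale delayed_variation =
  fixes x C \<tau> :: "real \<Rightarrow> real" and m t0 s :: real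
  assumes x_cont: "continuous_on {m..} x"
    and C_cont: "continuous_on {m..} C"
    and C_mono: "\<And>u v. m \<le> u \<Longrightarrow> u \<le> v \<Longrightarrow> C u \<le> C v"
    and variation: "\<And>u v K. \<lbrakk>t0 \<le> u; u \<le> v; \<And>t. t \<in> {u..v} \<Longrightarrow> \<bar>x (\<tau> t)\<bar> \<le> K\<rbrakk>
        \<Longrightarrow> \<bar>x v - x u\<bar> \<le> K * (C v - C u)"
    and delay: "\<And>t. t0 \<le> t \<Longrightarrow> m \<le> \<tau> t" "\<And>t. t0 \<le> t \<Longrightarrow> \<tau> t \<le> t"
        "\<And>t. t0 \<le> t \<Longrightarrow> C t - C (\<tau> t) \<le> s"
    and s: "s \<in> {1..2}"
begin

lemma m_le_t0: "m \<le> t0"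
  using delay[of t0] by linarith

text \<open>A perturbed profile \<open>F + e exp\<close> starts strictly above \<open>\<bar>x\<bar>\<close>. Up to a first contact, \<open>\<bar>x\<bar>\<close>
  grows no faster than the profile up to a quadratic error, which disappears on refinement.\<close>
lemma rise_le_profile:
  assumes H: "0 < H" and m': "m \<le> m'" and T: "t0 \<le> T" and A: "T \<le> A" "x A = 0" "A \<le> b"
    and hist: "\<And>t. T \<le> t \<Longrightarrow> m' \<le> \<tau> t" "\<And>t. A \<le> t \<Longrightarrow> T \<le> \<tau> t"
    and bound: "\<And>t. t \<in> {m'..b} \<Longrightarrow> \<bar>x t\<bar> \<le> H"
  shows "\<bar>x b\<bar> \<le> H * rise_profile s (C b - C A)"
proof -
  have m'T: "m' \<le> T" using hist(1)[of T] delay(2)[of T] T by linarith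
  define p where "p t = C t - C A" for t
  have p_mono: "p u \<le> p v" if "A \<le> u" "u \<le> v" for u v
    using C_mono[of u v] that A m' m'T by (simp add: p_def)
  have p_nn: "0 \<le> p u" if "A \<le> u" for u
    using p_mono[OF _ that] by (simp add: p_def)
  have perturbed: "\<bar>x b\<bar> \<le> H * (rise_profile s (p b) + e * exp (p b))" if e: "0 < e" for e
  proof (rule ccontr)
    define G where "G u = rise_profile s u + e * exp u" for u
    define W where "W t = G (p t) + p t" for t
    define \<phi> where "\<phi> t = H * G (p t) - \<bar>x t\<bar>" for t
    \<comment> \<open>\<open>exp\<close> is its own derivative: adding \<open>e * exp\<close> raises
      the rate by at most \<open>e * exp p\<close>, which the increment of \<open>e * exp\<close>
      pays for.\<close>
    have growth: "(q - p) * max (min 1 (s - q)) (G p) \<le> G q - G p" if "0 \<le> p" "p \<le> q" for p q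
    proof -
      have "exp p * (1 + (q - p)) \<le> exp p * exp (q - p)"
        by (intro mult_left_mono exp_ge_add_one_self) auto
      then have "exp p * (q - p) \<le> exp q - exp p"
        by (simp add: exp_add[symmetric] algebra_simps)
      then have E: "e * (exp p * (q - p)) \<le> e * (exp q - exp p)"
        using e by (intro mult_left_mono) auto
      have "0 \<le> e * exp p" using e by simp
      then have "max (min 1 (s - q)) (G p) \<le> max (min 1 (s - q)) (rise_profile s p) + e * exp p"
        by (auto simp: G_def max_def)
      then have "(q - p) * max (min 1 (s - q)) (G p)
          \<le> (q - p) * (max (min 1 (s - q)) (rise_profile s p) + e * exp p)"
        using that by (intro mult_left_mono) auto
      also have "\<dots> = (q - p) * max (min 1 (s - q)) (rise_profile s p) + e * (exp p * (q - p))"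
        by (simp add: algebra_simps)
      finally show ?thesis
        using E rise_profile_growth[OF s that] by (simp add: G_def algebra_simps)
    qed
    have G_nn: "0 \<le> G u" if "0 \<le> u" for u
      using rise_profile_nonneg[OF s that] e by (simp add: G_def)
    have G_mono: "G u \<le> G v" if "0 \<le> u" "u \<le> v" for u v
    proof -
      have "0 \<le> (v - u) * max (min 1 (s - v)) (G u)"
        using that G_nn[of u] by (intro mult_nonneg_nonneg) auto
      then show ?thesis using growth[OF that] by linarith
    qed
    have p_cont: "continuous_on {A..b} p"
      unfolding p_def using A m' m'T
      by (intro continuous_intros continuous_on_subset[OF C_cont]) auto
    have "continuous_on {A..b} (\<lambda>t. rise_profile s (p t))"
      using p_cont by (rule continuous_on_compose2[OF rise_profile_continuous[OF s, of UNIV]]) auto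
    then have \<phi>_cont: "continuous_on {A..b} (\<lambda>t. - \<phi> t)"
      unfolding \<phi>_def G_def using A m' m'T
      by (intro continuous_intros p_cont continuous_on_subset[OF x_cont]) auto
    \<comment> \<open>The perturbation provides this positive margin, which must be used up before a
      first contact.\<close>
    have \<phi>A: "\<phi> A = H * e"
      by (simp add: \<phi>_def G_def p_def A rise_profile_zero[OF s])
    assume "\<not> \<bar>x b\<bar> \<le> H * (rise_profile s (p b) + e * exp (p b))"
    then have "0 \<le> - \<phi> b" by (simp add: \<phi>_def G_def)
    moreover have "- \<phi> A \<le> 0" using \<phi>A H e by simp
    ultimately obtain c where c: "c \<in> {A..b}" "- \<phi> c = 0"
      and c_first: "\<And>t. t \<in> {A..<c} \<Longrightarrow> - \<phi> t < 0"
      using first_hitting_time[OF \<phi>_cont A(3)] by blast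
    have below: "\<bar>x t\<bar> \<le> H * G (p t)" if "t \<in> {A..c}" for t
      using c_first[of t] c(2) that by (cases "t = c") (auto simp: \<phi>_def)
    have step: "- (H * (p v - p u) * (W v - W u)) \<le> \<phi> v - \<phi> u"
      if uv: "A \<le> u" "u \<le> v" "v \<le> c" for u v
    proof -
      \<comment> \<open>\<open>K\<close> takes each rate at the end of \<open>[u, v]\<close> where
        it is largest, \<open>growth\<close> at the end where it is smallest; the discrepancy is at
        most the increment of \<open>W\<close>.\<close>
      define K where "K = max (min 1 (s - p u)) (G (p v))"
      have "\<bar>x (\<tau> t)\<bar> \<le> H * K" if t: "t \<in> {u..v}" for t
      proof (cases "\<tau> t \<le> A")
        case True
        have tt: "t0 \<le> t" "A \<le> t" "T \<le> t" using t uv T A by auto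
        \<comment> \<open>As \<open>x A = 0\<close>, the delayed value is a variation over the
          stretch from \<open>\<tau> t\<close> to \<open>A\<close>, whose clock length is at most
          \<open>s - p t\<close>.\<close>
        have "\<bar>x A - x (\<tau> t)\<bar> \<le> H * (C A - C (\<tau> t))"
        proof (rule variation)
          show "t0 \<le> \<tau> t" using hist(2)[OF tt(2)] T by linarith
          fix t' assume t': "t' \<in> {\<tau> t..A}"
          then have "T \<le> t'" using hist(2)[OF tt(2)] by auto
          then show "\<bar>x (\<tau> t')\<bar> \<le> H"
            using hist(1)[of t'] delay(2)[of t'] t' T A c(1) by (intro bound) auto
        qed (rule True)
        also have "\<dots> \<le> H * (s - p u)"
          using delay(3)[OF tt(1)] p_mono[of u t] t uv H by (intro mult_left_mono) (auto simp: p_def)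
        finally have "\<bar>x (\<tau> t)\<bar> \<le> H * (s - p u)" by (simp add: A)
        moreover have "\<bar>x (\<tau> t)\<bar> \<le> H * 1"
          using hist(1)[OF tt(3)] True A c(1) bound[of "\<tau> t"] by auto
        ultimately have "\<bar>x (\<tau> t)\<bar> \<le> H * min 1 (s - p u)" by (simp add: min_def)
        also have "\<dots> \<le> H * K"
          using H by (intro mult_left_mono) (auto simp: K_def)
        finally show ?thesis .
      next
        case False
        \<comment> \<open>A delayed time after \<open>A\<close> is no later than the first contact,
          so \<open>below\<close> applies to it.\<close>
        have "\<tau> t \<le> t" using t uv T A by (intro delay) auto
        then have "\<tau> t \<in> {A..c}" "p (\<tau> t) \<le> p v" "0 \<le> p (\<tau> t)"
          using False t uv p_mono[of "\<tau> t" v] p_nn[of "\<tau> t"] by auto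
        then have "\<bar>x (\<tau> t)\<bar> \<le> H * G (p (\<tau> t))" "G (p (\<tau> t)) \<le> K"
          using below G_mono[of "p (\<tau> t)" "p v"] by (auto simp: K_def)
        moreover have "H * G (p (\<tau> t)) \<le> H * K"
          using H calculation(2) by (intro mult_left_mono) auto
        ultimately show ?thesis by linarith
      qed
      then have "\<bar>x v - x u\<bar> \<le> H * K * (C v - C u)"
        using uv T A by (intro variation) auto
      then have 1: "\<bar>x v\<bar> - \<bar>x u\<bar> \<le> H * (K * (p v - p u))"
        by (simp add: p_def mult.assoc)
      have pp: "0 \<le> p u" "p u \<le> p v" using p_nn p_mono uv by auto
      have "K \<le> max (min 1 (s - p v)) (G (p u)) + (W v - W u)"
        using pp G_mono[OF pp] by (auto simp: K_def W_def)
      then have "K * (p v - p u) \<le> (max (min 1 (s - p v)) (G (p u)) + (W v - W u)) * (p v - p u)"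
        using pp by (intro mult_right_mono) auto
      also have "\<dots> \<le> G (p v) - G (p u) + (p v - p u) * (W v - W u)"
        using growth[OF pp] by (simp add: algebra_simps)
      finally have "H * (K * (p v - p u)) \<le> H * (G (p v) - G (p u) + (p v - p u) * (W v - W u))"
        using H by (intro mult_left_mono) auto
      with 1 show ?thesis by (simp add: \<phi>_def algebra_simps)
    qed
    have W_mono: "W u \<le> W v" if "A \<le> u" "u \<le> v" for u v
      using p_mono[OF that] p_nn that G_mono[of "p u" "p v"] by (auto simp: W_def)
    \<comment> \<open>The loss in \<open>step\<close> is a product of two increments. Where
      \<open>p\<close> varies by at most \<open>h\<close>, it is at most \<open>H * h\<close> times
      the increment of \<open>W\<close>, and such losses add up along a subdivision, which
      \<open>Bolzano\<close> supplies.\<close>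
    have telescoped: "\<phi> A + H * h * W A \<le> \<phi> c + H * h * W c" if h: "0 < h" for h
    proof -
      have "A \<le> A \<and> c \<le> c \<longrightarrow> \<phi> A + H * h * W A \<le> \<phi> c + H * h * W c"
      proof (rule Bolzano[where P = "\<lambda>u v. A \<le> u \<and> v \<le> c \<longrightarrow>
            \<phi> u + H * h * W u \<le> \<phi> v + H * h * W v"])
        show "A \<le> c" using c by simp
      next
        fix y assume y: "A \<le> y" "y \<le> c"
        have "continuous_on {A..c} p"
          using p_cont by (rule continuous_on_subset) (use c in auto)
        then obtain d where d: "d > 0"
          and close: "\<And>t. t \<in> {A..c} \<Longrightarrow> dist t y < d \<Longrightarrow> dist (p t) (p y) < h / 2"
          using y h unfolding continuous_on_iff by (metis atLeastAtMost_iff half_gt_zero)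
        have "\<phi> u + H * h * W u \<le> \<phi> v + H * h * W v"
          if uv: "u \<le> y" "y \<le> v" "v - u < d" "A \<le> u" "v \<le> c" for u v
        proof -
          have "dist (p u) (p y) < h / 2" "dist (p v) (p y) < h / 2"
            using close[of u] close[of v] uv by (auto simp: dist_real_def)
          then have "p v - p u \<le> h" unfolding dist_real_def by linarith
          then have "H * (p v - p u) * (W v - W u) \<le> H * h * (W v - W u)"
            using H W_mono[of u v] uv by (intro mult_right_mono mult_left_mono) auto
          then show ?thesis
            using step[of u v] uv by (simp add: algebra_simps)
        qed
        then show "\<exists>d>0. \<forall>u v. u \<le> y \<and> y \<le> v \<and> v - u < d \<longrightarrow>
            (A \<le> u \<and> v \<le> c \<longrightarrow> \<phi> u + H * h * W u \<le> \<phi> v + H * h * W v)"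
          using d by blast
      qed auto
      then show ?thesis by simp
    qed
    define \<Delta> where "\<Delta> = W c - W A"
    have \<Delta>: "0 \<le> \<Delta>" using W_mono c by (simp add: \<Delta>_def)
    \<comment> \<open>This makes the total loss \<open>H * h * \<Delta>\<close> smaller than the
      margin \<open>H * e\<close>.\<close>
    define h where "h = e / (1 + \<Delta>)"
    have "0 < h" using e \<Delta> by (simp add: h_def)
    then have "H * e \<le> H * h * \<Delta>"
      using telescoped[of h] c(2) \<phi>A by (simp add: \<Delta>_def algebra_simps)
    also have "\<dots> = H * e * (\<Delta> / (1 + \<Delta>))" by (simp add: h_def)
    also have "\<dots> < H * e * 1"
      using H e \<Delta> by (intro mult_strict_left_mono) auto
    finally show False by simp
  qed
  have "\<bar>x b\<bar> \<le> H * rise_profile s (p b) + e" if "0 < e" for e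
    using perturbed[of "e / (H * exp (p b))"] H that by (simp add: distrib_left)
  then show ?thesis
    unfolding p_def by (rule field_le_epsilon)
qed

text \<open>The profile bound read backwards. Boundedness uses it with \<open>r = 1\<close>, decay
  with \<open>r\<close> slightly below 1.\<close>

lemma rise_time:
  assumes H: "0 < H" and m': "m \<le> m'" and T: "t0 \<le> T" and A: "T \<le> A" "x A = 0" "A \<le> b"
    and hist: "\<And>t. T \<le> t \<Longrightarrow> m' \<le> \<tau> t" "\<And>t. A \<le> t \<Longrightarrow> T \<le> \<tau> t"
    and bound: "\<And>t. t \<in> {m'..b} \<Longrightarrow> \<bar>x t\<bar> \<le> H"
    and r: "r \<le> 1" "r * H \<le> \<bar>x b\<bar>"
  shows "Lambda s - 1 - (1 - r) / rise_threshold s \<le> C b - C A"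
proof (rule rise_profile_ge_imp_late[OF s])
  have "m' \<le> T" using hist(1)[of T] delay(2)[of T] T by linarith
  then show "0 \<le> C b - C A" using C_mono[of A b] A m' by simp
  have "H * r \<le> H * rise_profile s (C b - C A)"
    using rise_le_profile[OF H m' T A hist bound] r by (simp add: mult.commute)
  then show "r \<le> rise_profile s (C b - C A)" using H by simp
qed (rule r)

text \<open>The bound is the maximum of \<bar>x\<bar> up to a zero \<open>Z\<close> beyond
  \<open>T1\<close>. A larger value later would produce a strict record between two zeros, too
  expensive in clock time.\<close>

lemma bounded_if_rapidly_oscillating:
  assumes T1: "\<And>t. T1 \<le> t \<Longrightarrow> t0 \<le> \<tau> t" "t0 \<le> T1"
    and zeros: "\<And>T. \<exists>t\<ge>T. x t = 0"
    and rapid: "\<And>A B. \<lbrakk>T1 \<le> A; A < B; \<And>v. v \<in> {A<..<B} \<Longrightarrow> x v \<noteq> 0\<rbrakk> \<Longrightarrow> C B - C A \<le> l"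
    and l: "l \<le> Lambda s"
  shows "bounded (x ` {m..})"
proof -
  have xc: "continuous_on {p..q} x" if "m \<le> p" for p q
    using x_cont by (rule continuous_on_subset) (use that in auto)
  have axc: "continuous_on {p..q} (\<lambda>t. \<bar>x t\<bar>)" if "m \<le> p" for p q
    using xc[OF that] by (intro continuous_intros)
  have peak: "\<exists>v\<in>{m..q}. \<forall>t\<in>{m..q}. \<bar>x t\<bar> \<le> \<bar>x v\<bar>" if "m \<le> q" for q
    using continuous_attains_sup[OF compact_Icc _ axc[OF order_refl]] that by simp
  obtain Z where Z: "T1 \<le> Z" "x Z = 0" using zeros by blast
  have mZ: "m \<le> Z" using Z T1 m_le_t0 by linarith
  obtain tk where tk: "\<And>t. t \<in> {m..Z} \<Longrightarrow> \<bar>x t\<bar> \<le> \<bar>x tk\<bar>"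
    using peak[OF mZ] by blast
  define K where "K = \<bar>x tk\<bar>"
  have "\<bar>x t'\<bar> \<le> K" if t': "m \<le> t'" for t'
  proof (rule ccontr)
    assume nK: "\<not> \<bar>x t'\<bar> \<le> K"
    obtain Y where Y: "t' \<le> Y" "x Y = 0" using zeros by blast
    obtain tp where tp: "tp \<in> {m..Y}" "\<And>t. t \<in> {m..Y} \<Longrightarrow> \<bar>x t\<bar> \<le> \<bar>x tp\<bar>"
      using peak[of Y] Y t' by (meson order_trans)
    define P where "P = \<bar>x tp\<bar>"
    have KP: "K < P" using nK tp(2)[of t'] Y t' by (simp add: P_def)
    then have P: "0 < P" by (simp add: K_def)
    obtain tm where tm: "tm \<in> {m..tp}" "\<bar>x tm\<bar> = P" "\<And>t. t \<in> {m..<tm} \<Longrightarrow> \<bar>x t\<bar> < P"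
      using first_hitting_time[OF axc[of m tp], of P] tp by (auto simp: P_def)
    have "Z < tm" using tk[of tm] tm KP by (force simp: K_def)
    moreover have tmY: "tm \<le> Y" "x tm \<noteq> 0" using tm tp P by auto
    ultimately obtain A B where AB: "Z \<le> A" "A < tm" "tm < B" "B \<le> Y" "x A = 0" "x B = 0"
      "\<And>v. v \<in> {A<..<B} \<Longrightarrow> x v \<noteq> 0"
      using enclosing_zeros[OF xc[OF mZ] Z(2) less_imp_le Y(2) tmY] by blast
    have A: "m \<le> A" "t0 \<le> A" "T1 \<le> A" using AB Z T1 mZ by linarith+
    obtain ta where ta: "ta \<in> {m..A}" "\<And>t. t \<in> {m..A} \<Longrightarrow> \<bar>x t\<bar> \<le> \<bar>x ta\<bar>"
      using peak[OF A(1)] by blast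
    \<comment> \<open>The highest level up to \<open>A\<close>, raised to \<open>P / 2\<close> to be
      positive; it is below \<open>P\<close> because \<open>tm\<close> is the first time at height
      \<open>P\<close>.\<close>
    define H where "H = max \<bar>x ta\<bar> (P / 2)"
    have H: "0 < H" "H < P" using tm(3)[of ta] ta AB P by (auto simp: H_def)
    obtain b where b: "b \<in> {A..tm}" "\<bar>x b\<bar> = H" "\<And>t. t \<in> {A..<b} \<Longrightarrow> \<bar>x t\<bar> < H"
      using first_hitting_time[OF axc[OF A(1)], of tm H] AB H tm by auto
    have boundH: "\<bar>x t\<bar> \<le> H" if "t \<in> {m..b}" for t
      using ta(2)[of t] b(2) b(3)[of t] that by (cases "t \<le> A"; cases "t = b") (auto simp: H_def)
    have boundP: "\<bar>x (\<tau> t)\<bar> \<le> P" if "t0 \<le> t" "t \<le> B" for t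
      unfolding P_def using delay[of t] that AB by (intro tp) auto
    \<comment> \<open>Three costs: the rise from \<open>A\<close> to level \<open>H\<close>, the
      climb from \<open>H\<close> to \<open>P\<close> at speed at most \<open>P\<close>, and the
      fall to the zero \<open>B\<close>. The climb has positive cost, which rules out even
      \<open>l = Lambda s\<close>.\<close>
    have "Lambda s - 1 - (1 - 1) / rise_threshold s \<le> C b - C A"
      using rise_time[OF H(1) order_refl order_refl A(2) AB(5), of b 1] b delay(1) T1 A boundH by auto
    moreover have "P - H \<le> P * (C tm - C b)"
      using variation[of b tm P] b A tm AB boundP by auto
    then have "(P - H) / P \<le> C tm - C b"
      using P by (simp add: field_simps)
    moreover have "P \<le> P * (C B - C tm)"
      using variation[of tm B P] b A tm AB boundP by auto
    then have "1 \<le> C B - C tm" using P by simp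
    moreover have "0 < (P - H) / P" using H P by simp
    moreover have "C B - C A \<le> l" using AB A by (intro rapid) auto
    ultimately show False using l by simp
  qed
  then show ?thesis by (auto simp: bounded_iff)
qed

text \<open>If the limsup of \<bar>x\<bar> were positive, late excursions peaking close to it would
  rise and descend under a bound only slightly larger, and so need clock length above
  \<open>l\<close>.\<close>

lemma tendsto_zero_if_rapidly_oscillating:
  assumes bdd: "bounded (x ` {m..})"
    and \<tau>_lim: "filterlim \<tau> at_top at_top"
    and zeros: "\<And>T. \<exists>t\<ge>T. x t = 0"
    and rapid: "\<And>A B. \<lbrakk>T1 \<le> A; A < B; \<And>v. v \<in> {A<..<B} \<Longrightarrow> x v \<noteq> 0\<rbrakk> \<Longrightarrow> C B - C A \<le> l"
    and l: "l < Lambda s"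
  shows "(x \<longlongrightarrow> 0) at_top"
proof -
  \<comment> \<open>The eventual bounds of \<bar>x\<bar>; their infimum \<open>M\<close> is the
    limsup.\<close>
  define S where "S = {H. 0 \<le> H \<and> (\<forall>\<^sub>F t in at_top. \<bar>x t\<bar> \<le> H)}"
  define M where "M = Inf S"
  obtain K where "\<And>t. m \<le> t \<Longrightarrow> \<bar>x t\<bar> \<le> K"
    using bdd by (auto simp: bounded_iff)
  then have "\<bar>x t\<bar> \<le> max K 0" if "m \<le> t" for t
    using that by fastforce
  then have "max K 0 \<in> S"
    by (auto simp: S_def eventually_at_top_linorder)
  then have S_ne: "S \<noteq> {}" by blast
  have S_bdd: "bdd_below S" by (auto simp: S_def bdd_below_def)
  have M: "0 \<le> M" unfolding M_def using S_ne by (intro cInf_greatest) (auto simp: S_def)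
  have above: "\<forall>\<^sub>F t in at_top. \<bar>x t\<bar> \<le> H" if H: "M < H" for H
  proof -
    obtain H' where "H' \<in> S" "H' < H"
      using cInf_lessD[OF S_ne] H by (auto simp: M_def)
    then show ?thesis by (auto simp: S_def elim: eventually_mono)
  qed
  have "M = 0"
  proof (rule ccontr)
    assume "M \<noteq> 0"
    with M have M: "0 < M" by simp
    define w where "w = rise_threshold s"
    have w: "0 < w" using rise_threshold[OF s] by (simp add: w_def)
    \<comment> \<open>A peak at \<open>r * H\<close> instead of \<open>H\<close> saves at most
      \<open>(1 - r) / w\<close> in the rise and \<open>1 - r\<close> in the descent, together
      \<open>d * k\<close>; \<open>d\<close> keeps this below the gap
      \<open>Lambda s - l\<close>.\<close>
    define k where "k = 1 + 1 / w"
    define d where "d = min (1 / 2) ((Lambda s - l) / (2 * k))"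
    define r where "r = 1 - d"
    have k: "0 < k" using w by (simp add: k_def add_pos_pos)
    have d: "0 < d" "d < 1" using l k by (auto simp: d_def)
    then have r: "0 < r" "r < 1" by (auto simp: r_def)
    have "d * k \<le> (Lambda s - l) / (2 * k) * k"
      using k by (intro mult_right_mono) (auto simp: d_def)
    also have "\<dots> = (Lambda s - l) / 2" using k by simp
    also have "\<dots> < Lambda s - l" using l by simp
    finally have gap: "(1 - r) / w + (1 - r) < Lambda s - l"
      by (simp add: r_def k_def algebra_simps)
    \<comment> \<open>Chosen so that \<open>r * H < M < H\<close>: the level \<open>H\<close> is an
      eventual bound, while \<open>r * H\<close> is exceeded at arbitrarily late times.\<close>
    define H where "H = 2 * M / (1 + r)"
    have H: "0 < H" "M < H" using M r by (auto simp: H_def field_simps)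
    have rH: "0 \<le> r * H" "r * H < M" using M r by (auto simp: H_def field_simps)
    obtain m1 where m1: "\<And>t. m1 \<le> t \<Longrightarrow> \<bar>x t\<bar> \<le> H"
      using above[OF H(2)] by (auto simp: eventually_at_top_linorder)
    define m' where "m' = max m m1"
    have \<tau>_ge: "\<exists>T\<ge>a. \<forall>t\<ge>T. y \<le> \<tau> t" for y a
    proof -
      obtain T where "\<forall>t\<ge>T. y \<le> \<tau> t"
        using \<tau>_lim by (auto simp: filterlim_at_top eventually_at_top_linorder)
      then show ?thesis by (intro exI[of _ "max T a"]) auto
    qed
    \<comment> \<open>Two stages of history: beyond \<open>T\<close> delayed values are bounded by
      \<open>H\<close>, and beyond \<open>T2\<close> delayed times lie beyond
      \<open>T\<close>.\<close>
    obtain T where T: "t0 \<le> T" "\<And>t. T \<le> t \<Longrightarrow> m' \<le> \<tau> t" using \<tau>_ge by blast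
    obtain T2 where T2: "max T T1 \<le> T2" "\<And>t. T2 \<le> t \<Longrightarrow> T \<le> \<tau> t" using \<tau>_ge by blast
    obtain Z where Z: "T2 \<le> Z" "x Z = 0" using zeros by blast
    have "\<not> (\<forall>\<^sub>F t in at_top. \<bar>x t\<bar> \<le> r * H)"
    proof
      assume "\<forall>\<^sub>F t in at_top. \<bar>x t\<bar> \<le> r * H"
      then have "M \<le> r * H"
        unfolding M_def using rH S_bdd by (intro cInf_lower) (auto simp: S_def)
      with rH show False by simp
    qed
    then obtain tm where tm: "Z \<le> tm" "r * H < \<bar>x tm\<bar>"
      by (force simp: eventually_at_top_linorder not_le)
    obtain Y where Y: "tm \<le> Y" "x Y = 0" using zeros by blast
    have mZ: "m \<le> Z" using Z T T2 m_le_t0 by auto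
    have nz: "x tm \<noteq> 0" using tm rH by auto
    have "continuous_on {Z..Y} x"
      using x_cont by (rule continuous_on_subset) (use mZ in auto)
    then obtain A B where AB: "Z \<le> A" "A < tm" "tm < B" "B \<le> Y" "x A = 0" "x B = 0"
      "\<And>v. v \<in> {A<..<B} \<Longrightarrow> x v \<noteq> 0"
      using enclosing_zeros[OF _ Z(2) tm(1) Y(2,1) nz] by blast
    have "Lambda s - 1 - (1 - r) / w \<le> C tm - C A"
      unfolding w_def
      using rise_time[OF H(1) _ T(1) _ AB(5), of m' tm r] T T2 AB Z m1 r tm by (auto simp: m'_def)
    moreover have "\<bar>x B - x tm\<bar> \<le> H * (C B - C tm)"
      using AB tm Z T T2 by (intro variation m1) (auto simp: m'_def)
    then have "H * r < H * (C B - C tm)" using AB tm by (simp add: mult.commute)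
    then have "r < C B - C tm" using H by simp
    moreover have "C B - C A \<le> l" using AB Z T2 by (intro rapid) auto
    ultimately show False using gap by simp
  qed
  show ?thesis
  proof (rule tendstoI)
    fix e :: real assume "0 < e"
    then have "\<forall>\<^sub>F t in at_top. \<bar>x t\<bar> \<le> e / 2" using \<open>M = 0\<close> by (intro above) auto
    then show "\<forall>\<^sub>F t in at_top. dist (x t) 0 < e"
      by eventually_elim (use \<open>0 < e\<close> in auto)
  qed
qed

end

section \<open>From the differential equation to clock time\<close>

theorem theorem3p6:
  fixes c \<tau> :: "real \<Rightarrow> real" and a \<rho> l s :: real
  assumes c_measurable: "set_borel_measurable lebesgue {0..} c"
    and c_locally_integrable: "\<forall>t\<ge>0. set_integrable lebesgue {0..t} c"
    and tau_measurable: "set_borel_measurable lebesgue {0..} \<tau>"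
    and tau_delay: "\<forall>t\<ge>0. \<tau> t \<le> t"
    and tau_limit: "filterlim \<tau> at_top at_top"
    and a: "a \<ge> 0" "tau_min \<tau> a > 0"
    and rho: "\<rho> > Inf {t. t > 0 \<and> tau_min \<tau> t > ereal a}"
    and l: "l \<ge> 0"
    and s: "s \<in> {1..2}"
    and sup_le: "(SUP t\<in>{\<rho>..}. ereal (LINT \<zeta>:{\<tau> t..t}|lebesgue. \<bar>c \<zeta>\<bar>)) \<le> ereal s"
    and l_le: "l \<le> Lambda s"
  shows "(\<forall>t0\<ge>\<rho>. \<forall>x. is_solution c \<tau> t0 x \<longrightarrow> rapidly_oscillating c l t0 x \<longrightarrow>
            bounded (x ` solution_domain \<tau> t0)) \<and>
         (l < Lambda s \<longrightarrow>
          (\<forall>t0\<ge>\<rho>. \<forall>x. is_solution c \<tau> t0 x \<longrightarrow> rapidly_oscillating c l t0 x \<longrightarrow>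
            (x \<longlongrightarrow> 0) at_top))"
proof -
  define S where "S = {t. t > 0 \<and> tau_min \<tau> t > ereal a}"
  have tau_min_le: "tau_min \<tau> u \<le> ereal (\<tau> v)" if "u \<le> v" for u v
    unfolding tau_min_def using that by (intro INF_lower) auto
  have tau_min_mono: "tau_min \<tau> u \<le> tau_min \<tau> v" if "u \<le> v" for u v
    unfolding tau_min_def using that by (intro INF_superset_mono) auto
  \<comment> \<open>Makes \<open>Inf S\<close> a genuine infimum, so \<open>\<rho>\<close> lies
    above some element of \<open>S\<close>. By monotonicity \<open>tau_min \<tau> \<rho>\<close>
    exceeds \<open>a\<close>, and delayed times from \<open>\<rho>\<close> on stay where
    \<open>c\<close> is integrable.\<close>
  have "S \<noteq> {}"
  proof -
    obtain T where T: "\<And>t. T \<le> t \<Longrightarrow> a + 1 \<le> \<tau> t"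
      using tau_limit by (auto simp: filterlim_at_top eventually_at_top_linorder)
    have "ereal (a + 1) \<le> tau_min \<tau> (max T 1)"
      unfolding tau_min_def by (intro INF_greatest) (auto intro!: T)
    moreover have "ereal a < ereal (a + 1)" by simp
    ultimately have "ereal a < tau_min \<tau> (max T 1)" by (rule order.strict_trans2[rotated])
    then have "max T 1 \<in> S" by (auto simp: S_def)
    then show ?thesis by blast
  qed
  then obtain t\<rho> where "t\<rho> \<in> S" "t\<rho> < \<rho>"
    using cInf_lessD[of S \<rho>] rho by (auto simp: S_def)
  then have \<rho>: "0 < \<rho>" "ereal a < tau_min \<tau> \<rho>"
    using tau_min_mono[of t\<rho> \<rho>] by (auto simp: S_def)
  define C where "C t = integral {0..t} (\<lambda>v. \<bar>c v\<bar>)" for t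
  have c_abs: "set_integrable lebesgue {p..q} (\<lambda>v. \<bar>c v\<bar>)" if "0 \<le> p" "p \<le> q" for p q
  proof -
    have "set_integrable lebesgue {0..q} c" using c_locally_integrable that by auto
    then have "set_integrable lebesgue {p..q} c"
      by (rule set_integrable_subset) (use that in auto)
    then show ?thesis by (rule set_integrable_abs)
  qed
  \<comment> \<open>Links the Lebesgue integrals of the hypotheses to the gauge integrals defining
    the clock.\<close>
  note c_int = set_lebesgue_integral_eq_integral[OF c_abs]
  have C_diff: "integral {p..q} (\<lambda>v. \<bar>c v\<bar>) = C q - C p" if "0 \<le> p" "p \<le> q" for p q
    using Henstock_Kurzweil_Integration.integral_combine[of 0 p q "\<lambda>v. \<bar>c v\<bar>"] c_int(1)[of 0 q] that
    by (simp add: C_def)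
  have "continuous_on {0..q} C" if "0 \<le> q" for q
    unfolding C_def using c_int(1)[of 0 q] that by (intro indefinite_integral_continuous_1) auto
  then have C_cont: "continuous_on {0..} C"
    by (rule continuous_on_atLeast_if_Icc)
  have sup: "(LINT \<zeta>:{\<tau> t..t}|lebesgue. \<bar>c \<zeta>\<bar>) \<le> s" if "\<rho> \<le> t" for t
    using sup_le that by (auto simp: SUP_le_iff)
  have sol: "bounded (x ` solution_domain \<tau> t0) \<and> (l < Lambda s \<longrightarrow> (x \<longlongrightarrow> 0) at_top)"
    if t0: "\<rho> \<le> t0" and x: "is_solution c \<tau> t0 x" and osc: "rapidly_oscillating c l t0 x" for t0 x
  proof -
    \<comment> \<open>The left end of the domain is a real number, being above \<open>a\<close> and
      at most \<open>\<tau> t0\<close>.\<close>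
    obtain m where m: "tau_min \<tau> t0 = ereal m" "0 \<le> m"
    proof -
      have "ereal a < tau_min \<tau> t0" using \<rho>(2) tau_min_mono[OF t0] by (rule order.strict_trans2)
      moreover have "tau_min \<tau> t0 \<le> ereal (\<tau> t0)" by (rule tau_min_le) simp
      ultimately show ?thesis using that a(1) by (cases "tau_min \<tau> t0") auto
    qed
    have dom: "solution_domain \<tau> t0 = {m..}"
      by (auto simp: solution_domain_def m)
    have \<tau>_ge: "m \<le> \<tau> t" if "t0 \<le> t" for t
      using tau_min_le[OF that] by (simp add: m)
    have \<tau>_le: "\<tau> t \<le> t" if "t0 \<le> t" for t
      using tau_delay \<rho> t0 that by auto
    have mt0: "m \<le> t0" using \<tau>_ge[of t0] \<tau>_le[of t0] by simp
    have ac: "abs_cont_on_Icc p q x" if "m \<le> p" "p \<le> q" for p q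
      using x that by (simp add: is_solution_def dom)
    define sol_at where "sol_at t \<longleftrightarrow>
        (\<exists>D. (x has_real_derivative D) (at t) \<and> D + c t * x (\<tau> t) = 0)" for t
    have "AE t in lebesgue. t0 \<le> t \<longrightarrow> sol_at t"
      using x by (simp add: is_solution_def sol_at_def)
    then obtain N where N: "N \<in> null_sets lebesgue" "{t. \<not> (t0 \<le> t \<longrightarrow> sol_at t)} \<subseteq> N"
      by (auto simp: eventually_ae_filter)
    have eq: "sol_at t" if "t0 \<le> t" "t \<notin> N" for t
      using N(2) that by blast
    interpret delayed_variation x C \<tau> m t0 s
    proof
      show "continuous_on {m..} x"
        by (intro continuous_on_atLeast_if_Icc abs_cont_on_Icc_imp_continuous_on ac order_refl)
      show "continuous_on {m..} C"
        using C_cont by (rule continuous_on_subset) (use m in auto)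
      show "C u \<le> C v" if "m \<le> u" "u \<le> v" for u v
      proof -
        have "0 \<le> integral {u..v} (\<lambda>v. \<bar>c v\<bar>)"
          using c_int(1)[of u v] that m by (intro integral_nonneg) auto
        then show ?thesis using C_diff[of u v] that m by simp
      qed
      show "\<bar>x v - x u\<bar> \<le> K * (C v - C u)"
        if uv: "t0 \<le> u" "u \<le> v" and K: "\<And>t. t \<in> {u..v} \<Longrightarrow> \<bar>x (\<tau> t)\<bar> \<le> K" for u v K
      proof -
        have u: "m \<le> u" "0 \<le> u" using uv mt0 m by auto
        \<comment> \<open>Off the null set \<open>N\<close> the equation gives \<bar>x'\<bar> =
          \<bar>c\<bar> \<bar>x(\<tau> t)\<bar>, hence a derivative bounded by
          \<open>K * \<bar>c t\<bar>\<close>.\<close>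
        have "\<bar>x v - x u\<bar> \<le> integral {u..v} (\<lambda>t. K * \<bar>c t\<bar>)"
        proof (rule abs_cont_increment_le_integral[OF ac[OF u(1) uv(2)] uv(2)])
          show "negligible N" using N(1) negligible_iff_null_sets by blast
          show "(\<lambda>t. K * \<bar>c t\<bar>) integrable_on {u..v}"
            using c_int(1)[OF u(2) uv(2)] by (rule integrable_on_mult_right)
          fix t assume t: "t \<in> {u..v} - N"
          then obtain D where D: "(x has_real_derivative D) (at t)" "D + c t * x (\<tau> t) = 0"
            using eq[of t] uv by (auto simp: sol_at_def)
          have "\<bar>D\<bar> = \<bar>x (\<tau> t)\<bar> * \<bar>c t\<bar>"
            using D(2) by (simp add: add_eq_0_iff2 abs_mult mult.commute)
          also have "\<dots> \<le> K * \<bar>c t\<bar>" using K[of t] t by (intro mult_right_mono) auto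
          finally show "\<exists>D. (x has_real_derivative D) (at t) \<and> \<bar>D\<bar> \<le> K * \<bar>c t\<bar>"
            using D(1) by blast
        qed
        also have "\<dots> = K * (C v - C u)"
          using C_diff[OF u(2) uv(2)] by simp
        finally show ?thesis .
      qed
      show "C t - C (\<tau> t) \<le> s" if "t0 \<le> t" for t
        using sup[of t] t0 that c_int(2)[of "\<tau> t" t] C_diff[of "\<tau> t" t] \<tau>_ge[OF that] \<tau>_le[OF that] m
        by simp
    qed (use \<tau>_ge \<tau>_le s in auto)
    have zeros: "\<exists>t\<ge>T. x t = 0" for T
      using osc by (auto simp: rapidly_oscillating_def)
    obtain t1 where t1: "t0 \<le> t1" and rapid1: "\<forall>A\<in>{t1..}. \<forall>B\<in>{t1..}. A < B \<longrightarrow>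
        (\<forall>v\<in>{A<..<B}. x v \<noteq> 0) \<longrightarrow> (LINT v:{A..B}|lebesgue. \<bar>c v\<bar>) \<le> l"
      using osc unfolding rapidly_oscillating_def by blast
    have rapid: "C B - C A \<le> l" if "t1 \<le> A" "A < B" "\<And>v. v \<in> {A<..<B} \<Longrightarrow> x v \<noteq> 0" for A B
    proof -
      have AB: "0 \<le> A" "A \<le> B" using that t1 mt0 m by auto
      have "(LINT v:{A..B}|lebesgue. \<bar>c v\<bar>) \<le> l"
        using that by (intro rapid1[rule_format]) auto
      then show ?thesis
        using c_int(2)[OF AB] C_diff[OF AB] by simp
    qed
    \<comment> \<open>Beyond \<open>T\<close> delayed times lie in the range where the equation
      itself holds almost everywhere.\<close>
    obtain T where T: "\<And>t. T \<le> t \<Longrightarrow> t0 \<le> \<tau> t"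
      using tau_limit by (auto simp: filterlim_at_top eventually_at_top_linorder)
    have "bounded (x ` {m..})"
    proof (rule bounded_if_rapidly_oscillating[of "max T t1" l])
      show "\<exists>t\<ge>T'. x t = 0" for T' by (rule zeros)
      show "C B - C A \<le> l"
        if "max T t1 \<le> A" "A < B" "\<And>v. v \<in> {A<..<B} \<Longrightarrow> x v \<noteq> 0" for A B
        using that by (intro rapid) auto
    qed (use T t1 l_le in auto)
    moreover have "(x \<longlongrightarrow> 0) at_top" if "l < Lambda s"
      by (rule tendsto_zero_if_rapidly_oscillating[OF calculation tau_limit zeros rapid that])
    ultimately show ?thesis by (simp add: dom)
  qed
  show ?thesis using sol by blast
qed

end
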